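(* Let $\alpha,\beta$ be constants with $\alpha^2+\beta^2\neq 0$. For every $n\ge 0$, the coupled AKNS-Kaup-Newell system $u_t=K_n$, where $$K_n=J\begin{pmatrix}c_{n+1}\\ b_{n+1}\end{pmatrix}=\Phi^n\begin{pmatrix}2q\\-2r\end{pmatrix},$$ has a zero curvature representation $$U_t-V^{(n)}_x+[U,V^{(n)}]=0$$ with the Lax pair $U$, $V^{(n)}$. For each $n\ge 1$, this zero curvature equation is equivalent to the system $u_t=K_n=M\begin{pmatrix}c_n\\ b_n\end{pmatrix}=J\begin{pmatrix}c_{n+1}\\ b_{n+1}\end{pmatrix}$; for $n=0$, the system $u_t=K_0=(2q,-2r)^T$ has the Lax pair $U$, $V^{(0)}$.
   Context: Here $u=(q,r)^T$ with $q=q(x,t)$, $r=r(x,t)$, $\lambda$ is a spectral parameter (the zero curvature equation is understood identically in $\lambda$), $\partial=\partial/\partial x$, and $\partial^{-1}$ is the formal inverse of $\partial$, i.e. $\partial\partial^{-1}=\partial^{-1}\partial=1$. In operator expressions, $q,r$ denote multiplication operators and juxtaposition denotes composition. $[\cdot,\cdot]$ is the matrix commutator. Operators: $$J=\begin{pmatrix}-2\beta q\partial^{-1}q & 2+2\beta q\partial^{-1}r\\ -2+2\beta r\partial^{-1}q & -2\beta r\partial^{-1}r\end{pmatrix},\qquad M=\begin{pmatrix}2\alpha q\partial^{-1}q & \partial-2\alpha q\partial^{-1}r\\ \partial-2\alpha r\partial^{-1}q & 2\alpha r\partial^{-1}r\end{pmatrix},$$ $$\Phi=MJ^{-1}=\begin{pmatrix}\frac12\partial-\alpha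 q\partial^{-1}r-\frac12\beta\partial q\partial^{-1}r & -\alpha q\partial^{-1}q-\frac12\beta\partial q\partial^{-1}q\\ \alpha r\partial^{-1}r-\frac12\beta\partial r\partial^{-1}r & -\frac12\partial+\alpha r\partial^{-1}q-\frac12\beta\partial r\partial^{-1}q\end{pmatrix},$$ $$\Psi=J^{-1}M=\begin{pmatrix}-\frac12\partial+\alpha r\partial^{-1}q-\frac12\beta r\partial^{-1}q\partial & -\alpha r\partial^{-1}r-\frac12\beta r\partial^{-1}r\partial\\ \alpha q\partial^{-1}q-\frac12\beta q\partial^{-1}q\partial & \frac12\partial-\alpha q\partial^{-1}r-\frac12\beta q\partial^{-1}r\partial\end{pmatrix}.$$ Functions $a_i,b_i,c_i$ ($i\ge0$): $a_0=1$, $b_0=c_0=0$, $b_1=q$, $c_1=r$, and $$\begin{pmatrix}c_{i+1}\\ b_{i+1}\end{pmatrix}=\Psi\begin{pmatrix}c_i\\ b_i\end{pmatrix},\qquad a_i=\alpha\partial^{-1}(qc_i-rb_i)+\beta\partial^{-1}(qc_{i+1}-rb_{i+1}),\qquad i\ge1,$$ where zero constants of integration are always selected, that is, $a_i|_{[u]=0}=b_i|_{[u]=0}=c_i|_{[u]=0}=0$ for $i\ge 1$, with $[u]=(u,u_x,\dots)$. (For example, $c_2=\frac12(-r_x-\beta qr^2)$, $b_2=\frac12(q_x-\beta q^2r)$, $a_1=-\frac12\beta qr$.) Lax matrices: $$U=\begin{pmatrix}\lambda & q\\ (\alpha+\beta\lambda)r & -\lambda\end{pmatrix},\qquad V^{(n)}=\sum_{j=0}^n\begin{pmatrix}a_j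 & b_j\\ (\alpha+\beta\lambda)c_j & -a_j\end{pmatrix}\lambda^{n-j}+\begin{pmatrix}\delta_{1n}&0\\0&\delta_{2n}\end{pmatrix},$$ where $\delta_{1n}=-\delta_{2n}=-a_n+\alpha\partial^{-1}(qc_n-rb_n)$ for $n\ge1$, and $\delta_{10}=\delta_{20}=0$. *)

theory Defs
  imports "HOL-Analysis.Analysis" "HOL-Library.Poly_Mapping"
begin

text \<open>
  Differential polynomials in $u = (q,r)^T$ with constant coefficients in a field.
  The jet variable $(i,k)$ stands for the $k$-th $x$-derivative of the $i$-th component of $u$;
  a monomial is a finitely supported exponent function on the jet variables.
\<close>

type_synonym jetvar = "2 \<times> nat"

type_synonym 'k dpoly = "(jetvar \<Rightarrow>\<^sub>0 nat) \<Rightarrow>\<^sub>0 'k"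

definition Const :: "'k::zero \<Rightarrow> 'k dpoly" where
  "Const c = Poly_Mapping.single 0 c"

definition jet_var :: "jetvar \<Rightarrow> 'k::zero_neq_one dpoly" where
  "jet_var v = Poly_Mapping.single (Poly_Mapping.single v 1) 1"

definition qv :: "'k::zero_neq_one dpoly" where
  "qv = jet_var (1, 0)"

definition rv :: "'k::zero_neq_one dpoly" where
  "rv = jet_var (2, 0)"

text \<open>The total derivative: the derivation that kills constants and maps $(i,k)$ to $(i,k+1)$.\<close>

definition D :: "'k::comm_ring_1 dpoly \<Rightarrow> 'k dpoly" where
  "D p = (\<Sum>m\<in>Poly_Mapping.keys p. \<Sum>v\<in>Poly_Mapping.keys m.
            Poly_Mapping.single
              (m - Poly_Mapping.single v 1 + Poly_Mapping.single (fst v, Suc (snd v)) 1)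
              (of_nat (Poly_Mapping.lookup m v) * Poly_Mapping.lookup p m))"

text \<open>
  The value of a differential polynomial at $[u] = 0$ is its constant coefficient.
  On polynomials with vanishing constant coefficient \<^term>\<open>D\<close> is injective but not surjective.
  A formal inverse is a linear map with values in those polynomials (zero constants of integration)
  that undoes \<^term>\<open>D\<close> there; hence it is also a right inverse on the range of \<^term>\<open>D\<close>.
  Off the range of \<^term>\<open>D\<close> it is only required to be linear, which is what gives sense to the entries
  of operator matrices one at a time: the nonlocal contributions of the separate entries
  (for instance of $\partial^{-1}(qr)$ and $-\partial^{-1}(rq)$) cancel by linearity.
\<close>

definition formal_inverse :: "('k::comm_ring_1 dpoly \<Rightarrow> 'k dpoly) \<Rightarrow> bool" where
  "formal_inverse L \<longleftrightarrow>
     (\<forall>f g. L (f + g) = L f + L g) \<and>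
     (\<forall>c f. L (Const c * f) = Const c * L f) \<and>
     (\<forall>f. Poly_Mapping.lookup (L f) 0 = 0) \<and>
     (\<forall>f. Poly_Mapping.lookup f 0 = 0 \<longrightarrow> L (D f) = f)"

definition Dinv :: "'k::comm_ring_1 dpoly \<Rightarrow> 'k dpoly" where
  "Dinv = (SOME L. formal_inverse L)"

lemma lookup_Const_mult:
  fixes p :: "'k::comm_ring_1 dpoly"
  shows "Poly_Mapping.lookup (Const c * p) m = c * Poly_Mapping.lookup p m"
  unfolding Const_def mult_map_scale_conv_mult[symmetric]
  by (simp add: Poly_Mapping.map.rep_eq when_def)

lemma D_superset:
  fixes p :: "'k::comm_ring_1 dpoly"
  assumes "finite A" "Poly_Mapping.keys p \<subseteq> A"
  shows "D p = (\<Sum>m\<in>A. \<Sum>v\<in>Poly_Mapping.keys m.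
            Poly_Mapping.single
              (m - Poly_Mapping.single v 1 + Poly_Mapping.single (fst v, Suc (snd v)) 1)
              (of_nat (Poly_Mapping.lookup m v) * Poly_Mapping.lookup p m))"
  unfolding D_def using assms
  by (intro sum.mono_neutral_left) (auto simp: in_keys_iff)

lemma D_add:
  fixes p q :: "'k::comm_ring_1 dpoly"
  shows "D (p + q) = D p + D q"
proof -
  define A where "A = Poly_Mapping.keys p \<union> Poly_Mapping.keys q"
  have "finite A" "Poly_Mapping.keys p \<subseteq> A" "Poly_Mapping.keys q \<subseteq> A"
       "Poly_Mapping.keys (p + q) \<subseteq> A"
    unfolding A_def using keys_add[of p q] by auto
  then show ?thesis
    by (simp add: D_superset[of A] lookup_add distrib_left single_add sum.distrib)
qed

lemma D_scale:
  fixes p :: "'k::comm_ring_1 dpoly"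
  shows "D (Const c * p) = Const c * D p"
proof -
  have "finite (Poly_Mapping.keys p)" "Poly_Mapping.keys (Const c * p) \<subseteq> Poly_Mapping.keys p"
    by (auto simp: in_keys_iff lookup_Const_mult)
  then have "D (Const c * p) = (\<Sum>m\<in>Poly_Mapping.keys p. \<Sum>v\<in>Poly_Mapping.keys m.
            Poly_Mapping.single
              (m - Poly_Mapping.single v 1 + Poly_Mapping.single (fst v, Suc (snd v)) 1)
              (of_nat (Poly_Mapping.lookup m v) * Poly_Mapping.lookup (Const c * p) m))"
    by (rule D_superset)
  also have "\<dots> = Const c * D p"
    unfolding lookup_Const_mult by (simp add: D_def sum_distrib_left Const_def mult_single mult.left_commute)
  finally show ?thesis .
qed

lemma D_eq_0_imp:
  fixes p :: "'k::field_char_0 dpoly"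
  assumes D0: "D p = 0" and p0: "Poly_Mapping.lookup p 0 = 0"
  shows "p = 0"
proof (rule ccontr)
  assume "p \<noteq> 0"
  define V where "V = (\<Union>m\<in>Poly_Mapping.keys p. Poly_Mapping.keys m)"
  have finV: "finite V" by (simp add: V_def)
  obtain m0 where m0: "m0 \<in> Poly_Mapping.keys p" using \<open>p \<noteq> 0\<close> by (meson all_not_in_conv keys_eq_empty)
  have "m0 \<noteq> 0" using m0 p0 by (auto simp: in_keys_iff)
  then obtain v0 where "v0 \<in> Poly_Mapping.keys m0" by (meson all_not_in_conv keys_eq_empty)
  then have "V \<noteq> {}" using m0 unfolding V_def by blast
  define k where "k = Max (snd ` V)"
  have "k \<in> snd ` V" using finV \<open>V \<noteq> {}\<close> by (simp add: k_def)
  then obtain i where iV: "(i, k) \<in> V" by force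
  then obtain m where m: "m \<in> Poly_Mapping.keys p" "(i, k) \<in> Poly_Mapping.keys m"
    by (auto simp: V_def)
  have le: "snd v \<le> k" if "m' \<in> Poly_Mapping.keys p" "v \<in> Poly_Mapping.keys m'" for m' v
    using that finV by (auto simp: k_def V_def intro!: Max_ge)
  let ?f = "\<lambda>m' v. m' - Poly_Mapping.single v 1 + Poly_Mapping.single (fst v, Suc (snd v)) (1::nat)"
  have uniq: "?f m' v = ?f m (i, k) \<longleftrightarrow> m' = m \<and> v = (i, k)"
    if m': "m' \<in> Poly_Mapping.keys p" "v \<in> Poly_Mapping.keys m'" for m' v
  proof
    assume eq: "?f m' v = ?f m (i, k)"
    have "Poly_Mapping.lookup (?f m (i, k)) (i, Suc k) > 0" by (simp add: lookup_add)
    then have pos: "Poly_Mapping.lookup (?f m' v) (i, Suc k) > 0" by (simp only: eq)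
    have z: "Poly_Mapping.lookup m' (i, Suc k) = 0"
      using le[OF m'(1), of "(i, Suc k)"] by (force simp: in_keys_iff)
    from pos z have v: "v = (i, k)"
      by (cases v) (auto simp: lookup_add lookup_minus lookup_single when_def split: if_splits)
    from eq v have eq2: "m' - Poly_Mapping.single (i, k) 1 = m - Poly_Mapping.single (i, k) 1" by simp
    have "m' = m"
    proof (rule poly_mapping_eqI)
      fix w
      have "Poly_Mapping.lookup (m' - Poly_Mapping.single (i, k) 1) w
          = Poly_Mapping.lookup (m - Poly_Mapping.single (i, k) 1) w" by (simp only: eq2)
      moreover have "Poly_Mapping.lookup m' (i, k) > 0" "Poly_Mapping.lookup m (i, k) > 0"
        using m m' v by (auto simp: in_keys_iff)
      ultimately show "Poly_Mapping.lookup m' w = Poly_Mapping.lookup m w"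
        by (cases "w = (i, k)") (auto simp: lookup_minus lookup_single when_def)
    qed
    with v show "m' = m \<and> v = (i, k)" by simp
  qed simp
  have "Poly_Mapping.lookup (D p) (?f m (i, k)) =
      (\<Sum>m'\<in>Poly_Mapping.keys p. \<Sum>v\<in>Poly_Mapping.keys m'.
         if ?f m' v = ?f m (i, k) then of_nat (Poly_Mapping.lookup m' v) * Poly_Mapping.lookup p m' else 0)"
    unfolding D_def lookup_sum lookup_single when_def by simp
  also have "\<dots> = (\<Sum>m'\<in>Poly_Mapping.keys p. \<Sum>v\<in>Poly_Mapping.keys m'.
         if m' = m then (if v = (i, k) then of_nat (Poly_Mapping.lookup m v) * Poly_Mapping.lookup p m else 0) else 0)"
    by (intro sum.cong refl) (use uniq in auto)
  also have "\<dots> = (\<Sum>m'\<in>Poly_Mapping.keys p. if m' = m then \<Sum>v\<in>Poly_Mapping.keys m'.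
         (if v = (i, k) then of_nat (Poly_Mapping.lookup m v) * Poly_Mapping.lookup p m else 0) else 0)"
    by (intro sum.cong refl) auto
  also have "\<dots> = of_nat (Poly_Mapping.lookup m (i, k)) * Poly_Mapping.lookup p m"
    using m by (simp add: sum.delta)
  also have "\<dots> \<noteq> 0" using m by (simp add: in_keys_iff)
  finally show False using D0 by simp
qed

lemma formal_inverse_Dinv: "formal_inverse (Dinv :: 'k::field_char_0 dpoly \<Rightarrow> 'k dpoly)"
proof -
  let ?s = "\<lambda>c (f :: 'k dpoly). Const c * f"
  have Cadd: "Const (a + b) = Const a + (Const b :: 'k dpoly)" for a b by (simp add: Const_def single_add)
  have Cmul: "Const (a * b) = Const a * (Const b :: 'k dpoly)" for a b by (simp add: Const_def mult_single)
  have C1: "Const 1 = (1 :: 'k dpoly)" by (simp add: Const_def)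
  interpret vs: vector_space ?s
    by unfold_locales (simp_all add: algebra_simps Cadd Cmul C1)
  interpret vp: vector_space_pair ?s ?s by unfold_locales
  have lin: "Vector_Spaces.linear ?s ?s D"
    by unfold_locales (simp_all add: D_add D_scale)
  let ?A = "{f :: 'k dpoly. Poly_Mapping.lookup f 0 = 0}"
  have sub: "vs.subspace ?A"
    unfolding vs.subspace_def by (simp add: lookup_add lookup_Const_mult)
  have inj: "inj_on D ?A"
  proof (rule inj_onI)
    fix f g :: "'k dpoly"
    assume fg: "f \<in> ?A" "g \<in> ?A" "D f = D g"
    have "D (f - g) + D g = D f" by (simp flip: D_add)
    with fg have "D (f - g) = 0" by simp
    moreover have "Poly_Mapping.lookup (f - g) 0 = 0" using fg by (simp add: lookup_minus)
    ultimately show "f = g" using D_eq_0_imp by fastforce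
  qed
  from vp.linear_exists_left_inverse_on[OF lin sub inj]
  obtain L where L: "Vector_Spaces.linear ?s ?s L" "\<forall>f\<in>?A. L (D f) = f" "range L \<subseteq> ?A" by blast
  interpret L: Vector_Spaces.linear ?s ?s L by (rule L)
  have "formal_inverse L"
    unfolding formal_inverse_def using L(2,3) by (auto simp: L.add L.scale)
  then show ?thesis unfolding Dinv_def by (rule someI[where P = formal_inverse])
qed


text \<open>Matrices of operators, acting on column vectors of differential polynomials.\<close>

type_synonym 'k op_matrix = "('k dpoly \<Rightarrow> 'k dpoly)^2^2"

definition mat22 :: "'a \<Rightarrow> 'a \<Rightarrow> 'a \<Rightarrow> 'a \<Rightarrow> 'a^2^2" where
  "mat22 a b c d = (\<chi> i j. if i = 1 then (if j = 1 then a else b) else (if j = 1 then c else d))"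

definition op_apply :: "'k::comm_ring_1 op_matrix \<Rightarrow> 'k dpoly^2 \<Rightarrow> 'k dpoly^2" where
  "op_apply A w = (\<chi> i. \<Sum>j\<in>UNIV. (A $ i $ j) (w $ j))"

definition J_op :: "'k::field \<Rightarrow> 'k op_matrix" where
  "J_op \<beta> = mat22
     (\<lambda>f. - Const (2 * \<beta>) * qv * Dinv (qv * f))
     (\<lambda>f. 2 * f + Const (2 * \<beta>) * qv * Dinv (rv * f))
     (\<lambda>f. - 2 * f + Const (2 * \<beta>) * rv * Dinv (qv * f))
     (\<lambda>f. - Const (2 * \<beta>) * rv * Dinv (rv * f))"

definition M_op :: "'k::field \<Rightarrow> 'k op_matrix" where
  "M_op \<alpha> = mat22
     (\<lambda>f. Const (2 * \<alpha>) * qv * Dinv (qv * f))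
     (\<lambda>f. D f - Const (2 * \<alpha>) * qv * Dinv (rv * f))
     (\<lambda>f. D f - Const (2 * \<alpha>) * rv * Dinv (qv * f))
     (\<lambda>f. Const (2 * \<alpha>) * rv * Dinv (rv * f))"

definition Phi_op :: "'k::field \<Rightarrow> 'k \<Rightarrow> 'k op_matrix" where
  "Phi_op \<alpha> \<beta> = mat22
     (\<lambda>f. Const (1/2) * D f - Const \<alpha> * qv * Dinv (rv * f) - Const (\<beta>/2) * D (qv * Dinv (rv * f)))
     (\<lambda>f. - Const \<alpha> * qv * Dinv (qv * f) - Const (\<beta>/2) * D (qv * Dinv (qv * f)))
     (\<lambda>f. Const \<alpha> * rv * Dinv (rv * f) - Const (\<beta>/2) * D (rv * Dinv (rv * f)))
     (\<lambda>f. - Const (1/2) * D f + Const \<alpha> * rv * Dinv (qv * f) - Const (\<beta>/2) * D (rv * Dinv (qv * f)))"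

definition Psi_op :: "'k::field \<Rightarrow> 'k \<Rightarrow> 'k op_matrix" where
  "Psi_op \<alpha> \<beta> = mat22
     (\<lambda>f. - Const (1/2) * D f + Const \<alpha> * rv * Dinv (qv * f) - Const (\<beta>/2) * rv * Dinv (qv * D f))
     (\<lambda>f. - Const \<alpha> * rv * Dinv (rv * f) - Const (\<beta>/2) * rv * Dinv (rv * D f))
     (\<lambda>f. Const \<alpha> * qv * Dinv (qv * f) - Const (\<beta>/2) * qv * Dinv (qv * D f))
     (\<lambda>f. Const (1/2) * D f - Const \<alpha> * qv * Dinv (rv * f) - Const (\<beta>/2) * qv * Dinv (rv * D f))"


text \<open>The column vector $(c_i, b_i)^T$, in this order.\<close>

fun cb_seq :: "'k::field \<Rightarrow> 'k \<Rightarrow> nat \<Rightarrow> 'k dpoly^2" where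
  "cb_seq \<alpha> \<beta> 0 = vector [0, 0]"
| "cb_seq \<alpha> \<beta> (Suc 0) = vector [rv, qv]"
| "cb_seq \<alpha> \<beta> (Suc (Suc i)) = op_apply (Psi_op \<alpha> \<beta>) (cb_seq \<alpha> \<beta> (Suc i))"

definition c_seq :: "'k::field \<Rightarrow> 'k \<Rightarrow> nat \<Rightarrow> 'k dpoly" where
  "c_seq \<alpha> \<beta> i = cb_seq \<alpha> \<beta> i $ 1"

definition b_seq :: "'k::field \<Rightarrow> 'k \<Rightarrow> nat \<Rightarrow> 'k dpoly" where
  "b_seq \<alpha> \<beta> i = cb_seq \<alpha> \<beta> i $ 2"

definition a_seq :: "'k::field \<Rightarrow> 'k \<Rightarrow> nat \<Rightarrow> 'k dpoly" where
  "a_seq \<alpha> \<beta> i =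
     (if i = 0 then 1
      else Const \<alpha> * Dinv (qv * c_seq \<alpha> \<beta> i - rv * b_seq \<alpha> \<beta> i)
         + Const \<beta> * Dinv (qv * c_seq \<alpha> \<beta> (Suc i) - rv * b_seq \<alpha> \<beta> (Suc i)))"

definition K_vec :: "'k::field \<Rightarrow> 'k \<Rightarrow> nat \<Rightarrow> 'k dpoly^2" where
  "K_vec \<alpha> \<beta> n = op_apply (J_op \<beta>) (cb_seq \<alpha> \<beta> (Suc n))"


definition U_mat :: "'k::field \<Rightarrow> 'k \<Rightarrow> 'k \<Rightarrow> 'k dpoly^2^2" where
  "U_mat \<alpha> \<beta> l = mat22
     (Const l) qv
     (Const (\<alpha> + \<beta> * l) * rv) (- Const l)"

definition delta1 :: "'k::field \<Rightarrow> 'k \<Rightarrow> nat \<Rightarrow> 'k dpoly" where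
  "delta1 \<alpha> \<beta> n =
     (if n = 0 then 0
      else - a_seq \<alpha> \<beta> n + Const \<alpha> * Dinv (qv * c_seq \<alpha> \<beta> n - rv * b_seq \<alpha> \<beta> n))"

definition delta2 :: "'k::field \<Rightarrow> 'k \<Rightarrow> nat \<Rightarrow> 'k dpoly" where
  "delta2 \<alpha> \<beta> n = - delta1 \<alpha> \<beta> n"

definition V_mat :: "'k::field \<Rightarrow> 'k \<Rightarrow> nat \<Rightarrow> 'k \<Rightarrow> 'k dpoly^2^2" where
  "V_mat \<alpha> \<beta> n l =
     (\<Sum>j=0..n. mat22
        (a_seq \<alpha> \<beta> j * Const (l ^ (n - j)))
        (b_seq \<alpha> \<beta> j * Const (l ^ (n - j)))
        (Const (\<alpha> + \<beta> * l) * c_seq \<alpha> \<beta> j * Const (l ^ (n - j)))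
        (- a_seq \<alpha> \<beta> j * Const (l ^ (n - j))))
     + mat22 (delta1 \<alpha> \<beta> n) 0 0 (delta2 \<alpha> \<beta> n)"


text \<open>
  Evaluation on functions $u(x,t)$. The scalars form a \<^class>\<open>real_normed_field\<close>, so real-valued
  and complex-valued $u$ are both covered; $x$ and $t$ are real.
\<close>

definition dx :: "(real \<Rightarrow> real \<Rightarrow> 'v::real_normed_vector) \<Rightarrow> real \<Rightarrow> real \<Rightarrow> 'v" where
  "dx f x t = vector_derivative (\<lambda>y. f y t) (at x)"

definition dt :: "(real \<Rightarrow> real \<Rightarrow> 'v::real_normed_vector) \<Rightarrow> real \<Rightarrow> real \<Rightarrow> 'v" where
  "dt f x t = vector_derivative (\<lambda>s. f x s) (at t)"

text \<open>
  The only regularity needed: all $x$-derivatives and the first $t$-derivative exist. Every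
  $C^\infty$ function satisfies this.
\<close>

definition admissible_on :: "(real \<times> real) set \<Rightarrow> (real \<Rightarrow> real \<Rightarrow> 'v::real_normed_vector) \<Rightarrow> bool" where
  "admissible_on S u \<longleftrightarrow>
     (\<forall>(x, t)\<in>S. (\<forall>k. (\<lambda>y. (dx ^^ k) u y t) differentiable (at x)) \<and>
                   (\<lambda>s. u x s) differentiable (at t))"

definition eval_at :: "'k::real_normed_field dpoly \<Rightarrow> (real \<Rightarrow> real \<Rightarrow> 'k^2) \<Rightarrow> real \<Rightarrow> real \<Rightarrow> 'k" where
  "eval_at p u x t =
     (\<Sum>m\<in>Poly_Mapping.keys p. Poly_Mapping.lookup p m *
        (\<Prod>v\<in>Poly_Mapping.keys m. ((dx ^^ snd v) u x t $ fst v) ^ Poly_Mapping.lookup m v))"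

definition eval_vec ::
  "'k::real_normed_field dpoly^2 \<Rightarrow> (real \<Rightarrow> real \<Rightarrow> 'k^2) \<Rightarrow> real \<Rightarrow> real \<Rightarrow> 'k^2" where
  "eval_vec w u x t = (\<chi> i. eval_at (w $ i) u x t)"

definition eval_mat ::
  "'k::real_normed_field dpoly^2^2 \<Rightarrow> (real \<Rightarrow> real \<Rightarrow> 'k^2) \<Rightarrow> real \<Rightarrow> real \<Rightarrow> 'k^2^2" where
  "eval_mat A u x t = (\<chi> i j. eval_at (A $ i $ j) u x t)"

definition commutator :: "'k::comm_ring_1^2^2 \<Rightarrow> 'k^2^2 \<Rightarrow> 'k^2^2" where
  "commutator A B = A ** B - B ** A"

definition evolution_on ::
  "(real \<times> real) set \<Rightarrow> (real \<Rightarrow> real \<Rightarrow> 'k::real_normed_field^2) \<Rightarrow> 'k dpoly^2 \<Rightarrow> bool" where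
  "evolution_on S u K \<longleftrightarrow> (\<forall>(x, t)\<in>S. dt u x t = eval_vec K u x t)"

definition zero_curvature_on ::
  "(real \<times> real) set \<Rightarrow> (real \<Rightarrow> real \<Rightarrow> 'k::real_normed_field^2) \<Rightarrow>
     ('k \<Rightarrow> 'k dpoly^2^2) \<Rightarrow> ('k \<Rightarrow> 'k dpoly^2^2) \<Rightarrow> bool" where
  "zero_curvature_on S u U V \<longleftrightarrow>
     (\<forall>(x, t)\<in>S. \<forall>l.
        dt (eval_mat (U l) u) x t - dx (eval_mat (V l) u) x t
          + commutator (eval_mat (U l) u x t) (eval_mat (V l) u x t) = 0)"

end

theory Submission
  imports Defs "HOL-Computational_Algebra.Formal_Power_Series"
begin

text \<open>
  Put $f_i = \partial^{-1}(qc_i - rb_i)$. By linearity of $\partial^{-1}$ alone, $\Psi$ is equivalent to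
  $2b_{i+1} = b_{i,x} + 2qa_i$, $2c_{i+1} = -c_{i,x} + 2ra_i$ with $a_i = \alpha f_i + \beta f_{i+1}$,
  and these give all identities between $K_n$, $J$, $M$, $\Phi$ and every entry of the zero curvature
  equation except the diagonal one. The diagonal entry needs that $\partial f_i = qc_i - rb_i$ really
  holds, that is, $qc_i - rb_i$ is a total derivative. This comes from the conservation of the
  determinant of the stationary solution $\sum_j V_j \lambda^{-j}$: with $z = \lambda^{-1}$,
  $\kappa = \alpha z + \beta$ and the generating series $zP, zB, zC$ of $f, b, c$, that determinant is
  $-1 - \kappa (2P + Q)$ where $Q = \kappa P^2 + zBC$, and the recursion gives
  $Q_x = 2\kappa P (P_x - G) - 2G$ with $G = qC - rB$. Since $\kappa P$ has no constant term, the
  $n$-th coefficient of $G$ is the $x$-derivative of that of $-\frac12 Q$ as soon as $P_x = G$ holds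
  in all lower orders.
\<close>

subsection \<open>Differential polynomials\<close>

text \<open>Serves at two levels: for differential polynomials as sums of terms, and for their
  exponent functions, which are finitely supported maps themselves.\<close>

lemma poly_mapping_additive_induct [case_names single add]:
  fixes p :: "'a \<Rightarrow>\<^sub>0 'b::comm_monoid_add"
  assumes single: "\<And>k v. P (Poly_Mapping.single k v)"
    and add: "\<And>p q. P p \<Longrightarrow> P q \<Longrightarrow> P (p + q)"
  shows "P p"
proof (induction p rule: update_induct)
  case const
  show ?case using single[of undefined 0] by simp
next
  case (update p a b)
  \<comment> \<open>The key \<open>a\<close> lies outside the support of \<open>p\<close>, so
    nothing is overwritten.\<close>
  have "Poly_Mapping.update a b p = p + Poly_Mapping.single a b"
    using update.hyps
    by (intro poly_mapping_eqI) (auto simp: lookup_update lookup_add lookup_single when_def in_keys_iff)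
  with update.IH single add show ?case by simp
qed

text \<open>Constants and jet variables generate the ring. This reduces the compatibility of
  evaluation with the x-derivative to these generators.\<close>

lemma dpoly_induct [case_names Const jet_var add mult]:
  fixes p :: "'k::comm_ring_1 dpoly"
  assumes Const: "\<And>c. P (Const c)"
    and jet_var: "\<And>v. P (jet_var v)"
    and add: "\<And>p q. P p \<Longrightarrow> P q \<Longrightarrow> P (p + q)"
    and mult: "\<And>p q. P p \<Longrightarrow> P q \<Longrightarrow> P (p * q)"
  shows "P p"
proof -
  have "P (Poly_Mapping.single m 1)" for m :: "jetvar \<Rightarrow>\<^sub>0 nat"
  proof (induction m rule: poly_mapping_additive_induct)
    case (single v k)
    show ?case
    proof (induction k)
      case 0
      show ?case using Const[of 1] by (simp add: Const_def)
    next
      case (Suc k)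
      have "Poly_Mapping.single (Poly_Mapping.single v (Suc k)) (1::'k)
          = jet_var v * Poly_Mapping.single (Poly_Mapping.single v k) 1"
        by (simp add: jet_var_def mult_single single_add[symmetric])
      with mult[OF jet_var Suc] show ?case by simp
    qed
  next
    case (add m m')
    have "Poly_Mapping.single (m + m') (1::'k) = Poly_Mapping.single m 1 * Poly_Mapping.single m' 1"
      by (simp add: mult_single)
    with mult[OF add] show ?case by simp
  qed
  then have "P (Poly_Mapping.single m c)" for m c
    using mult[OF Const[of c]] by (force simp: Const_def mult_single)
  then show ?thesis using add by (rule poly_mapping_additive_induct)
qed

section \<open>Scalars embedded as constant polynomials\<close>

lemma Const_0 [simp]: "Const 0 = (0 :: 'k::comm_ring_1 dpoly)"
  by (simp add: Const_def)

lemma Const_1 [simp]: "Const 1 = (1 :: 'k::comm_ring_1 dpoly)"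
  by (simp add: Const_def)

lemma Const_add: "Const (a + b) = Const a + (Const b :: 'k::comm_ring_1 dpoly)"
  by (simp add: Const_def single_add)

lemma Const_mult: "Const (a * b) = Const a * (Const b :: 'k::comm_ring_1 dpoly)"
  by (simp add: Const_def mult_single)

lemma Const_uminus: "Const (- a) = - (Const a :: 'k::comm_ring_1 dpoly)"
  by (simp add: Const_def single_uminus)

lemma Const_2: "Const 2 = (2 :: 'k::comm_ring_1 dpoly)"
  using Const_add[of "1::'k" 1] by simp

lemma Const_half: "Const (1/2) + Const (1/2) = (1 :: 'k::field_char_0 dpoly)"
  using Const_add[of "1/2::'k" "1/2"] by simp

lemma half_double: "2 * (Const (1/2) * p) = (p :: 'k::field_char_0 dpoly)"
  using Const_half[where 'k='k] by (metis distrib_right mult_1 mult_2)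

lemma Const_divide_2: "Const (a / 2) = Const (1/2) * (Const a :: 'k::field_char_0 dpoly)"
  by (simp flip: Const_mult)

section \<open>The total derivative as a derivation\<close>

lemma D_single_superset:
  fixes c :: "'k::comm_ring_1"
  assumes "finite A" "Poly_Mapping.keys m \<subseteq> A"
  shows "D (Poly_Mapping.single m c) = (\<Sum>v\<in>A. Poly_Mapping.single
            (m - Poly_Mapping.single v 1 + Poly_Mapping.single (fst v, Suc (snd v)) 1)
            (of_nat (Poly_Mapping.lookup m v) * c))"
proof -
  have "D (Poly_Mapping.single m c) = (\<Sum>v\<in>Poly_Mapping.keys m. Poly_Mapping.single
            (m - Poly_Mapping.single v 1 + Poly_Mapping.single (fst v, Suc (snd v)) 1)
            (of_nat (Poly_Mapping.lookup m v) * c))"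
    by (subst D_superset[of "{m}"]) auto
  also have "\<dots> = (\<Sum>v\<in>A. Poly_Mapping.single
            (m - Poly_Mapping.single v 1 + Poly_Mapping.single (fst v, Suc (snd v)) 1)
            (of_nat (Poly_Mapping.lookup m v) * c))"
    using assms by (intro sum.mono_neutral_left) (auto simp: in_keys_iff)
  finally show ?thesis .
qed

lemma D_Const [simp]: "D (Const c) = (0 :: 'k::comm_ring_1 dpoly)"
  unfolding Const_def by (subst D_single_superset[of "{}"]) auto

lemma D_jet_var: "D (jet_var (i, k)) = (jet_var (i, Suc k) :: 'k::comm_ring_1 dpoly)"
  unfolding jet_var_def by (subst D_single_superset[of "{(i, k)}"]) auto

lemma D_0 [simp]: "D 0 = (0 :: 'k::comm_ring_1 dpoly)"
  using D_Const[of "0::'k"] by simp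

lemma D_1 [simp]: "D 1 = (0 :: 'k::comm_ring_1 dpoly)"
  using D_Const[of "1::'k"] by simp

lemma D_uminus: "D (- p) = - D (p :: 'k::comm_ring_1 dpoly)"
  using D_add[of p "- p"] by (simp add: eq_neg_iff_add_eq_0 add.commute)

lemma D_diff: "D (p - q) = D p - D (q :: 'k::comm_ring_1 dpoly)"
  using D_add[of p "- q"] by (simp add: D_uminus)

lemma D_mult_2: "D (2 * p) = 2 * D (p :: 'k::comm_ring_1 dpoly)"
  by (simp only: mult_2 D_add)

lemma D_sum: "D (sum f A) = (\<Sum>i\<in>A. D (f i :: 'k::comm_ring_1 dpoly))"
  by (induction A rule: infinite_finite_induct) (simp_all add: D_add)

lemma D_mult_single:
  fixes c c' :: "'k::comm_ring_1"
  shows "D (Poly_Mapping.single m c * Poly_Mapping.single m' c')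
    = D (Poly_Mapping.single m c) * Poly_Mapping.single m' c'
      + Poly_Mapping.single m c * D (Poly_Mapping.single m' c')"
proof -
  \<comment> \<open>One index set for \<open>m\<close>, \<open>m'\<close> and \<open>m + m'\<close>;
    variables absent from an exponent contribute coefficient 0.\<close>
  define A where "A = Poly_Mapping.keys m \<union> Poly_Mapping.keys m'"
  define e where "e v = Poly_Mapping.single v (1::nat)" for v :: jetvar
  define s where "s v = Poly_Mapping.single (fst v, Suc (snd v)) (1::nat)" for v :: jetvar
  have A: "finite A" "Poly_Mapping.keys m \<subseteq> A" "Poly_Mapping.keys m' \<subseteq> A"
    "Poly_Mapping.keys (m + m') \<subseteq> A"
    unfolding A_def using keys_add[of m m'] by auto
  \<comment> \<open>Exponent subtraction is truncated, so it commutes with adding \<open>n'\<close>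
    only if \<open>v\<close> occurs in \<open>n\<close>; otherwise the coefficient makes both sides
    0.\<close>
  have shift: "Poly_Mapping.single (n + n' - e v + s v) (of_nat (Poly_Mapping.lookup n v) * d * d')
    = Poly_Mapping.single (n - e v + s v) (of_nat (Poly_Mapping.lookup n v) * d) * Poly_Mapping.single n' d'"
    for n n' v and d d' :: 'k
  proof (cases "Poly_Mapping.lookup n v = 0")
    case False
    have "n + n' - e v = n - e v + n'"
      using False
      by (intro poly_mapping_eqI) (auto simp: e_def lookup_add lookup_minus lookup_single when_def)
    then show ?thesis by (simp add: mult_single ac_simps)
  qed simp
  have D_single: "D (Poly_Mapping.single n d)
      = (\<Sum>v\<in>A. Poly_Mapping.single (n - e v + s v) (of_nat (Poly_Mapping.lookup n v) * d))"
    if "Poly_Mapping.keys n \<subseteq> A" for n and d :: 'k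
    unfolding e_def s_def using A(1) that by (rule D_single_superset)
  have "D (Poly_Mapping.single m c * Poly_Mapping.single m' c')
      = (\<Sum>v\<in>A. Poly_Mapping.single (m + m' - e v + s v) (of_nat (Poly_Mapping.lookup m v) * c * c'))
      + (\<Sum>v\<in>A. Poly_Mapping.single (m' + m - e v + s v) (of_nat (Poly_Mapping.lookup m' v) * c' * c))"
    by (simp add: mult_single D_single[OF A(4)] lookup_add distrib_right distrib_left single_add sum.distrib ac_simps)
  also have "\<dots> = D (Poly_Mapping.single m c) * Poly_Mapping.single m' c'
      + Poly_Mapping.single m c * D (Poly_Mapping.single m' c')"
    unfolding shift by (simp add: D_single A sum_distrib_left sum_distrib_right mult.commute)
  finally show ?thesis .
qed

lemma D_mult:
  fixes p q :: "'k::comm_ring_1 dpoly"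
  shows "D (p * q) = D p * q + p * D q"
proof (induction p rule: poly_mapping_additive_induct)
  case (single m c)
  show ?case
    by (induction q rule: poly_mapping_additive_induct)
      (simp_all add: D_mult_single D_add algebra_simps)
qed (simp add: D_add algebra_simps)

subsection \<open>The formal inverse of the total derivative\<close>

lemma Dinv_add: "Dinv (f + g) = Dinv f + Dinv (g :: 'k::field_char_0 dpoly)"
  using formal_inverse_Dinv unfolding formal_inverse_def by blast

lemma Dinv_scale: "Dinv (Const c * f) = Const c * Dinv (f :: 'k::field_char_0 dpoly)"
  using formal_inverse_Dinv unfolding formal_inverse_def by blast

lemma Dinv_0 [simp]: "Dinv 0 = (0 :: 'k::field_char_0 dpoly)"
  using Dinv_scale[of 0 "0 :: 'k dpoly"] by simp

lemma Dinv_uminus: "Dinv (- f) = - Dinv (f :: 'k::field_char_0 dpoly)"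
  using Dinv_add[of f "- f"] by (simp add: eq_neg_iff_add_eq_0 add.commute)

lemma Dinv_diff: "Dinv (f - g) = Dinv f - Dinv (g :: 'k::field_char_0 dpoly)"
  using Dinv_add[of f "- g"] by (simp add: Dinv_uminus)

text \<open>\<open>Dinv\<close> undoes \<open>D\<close> only on polynomials without constant
  coefficient; removing that coefficient from \<open>f\<close> leaves \<open>D f\<close>
  unchanged.\<close>

lemma D_Dinv_D: "D (Dinv (D f)) = D (f :: 'k::field_char_0 dpoly)"
proof -
  define g where "g = f - Const (Poly_Mapping.lookup f 0)"
  have "Poly_Mapping.lookup g 0 = 0" by (simp add: g_def lookup_minus Const_def)
  moreover have "D f = D g" by (simp add: g_def D_diff)
  ultimately show ?thesis
    using formal_inverse_Dinv unfolding formal_inverse_def by metis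
qed

subsection \<open>The recursion\<close>

text \<open>This is f_i above. Up to \<open>D_nonloc\<close>, only linearity of \<open>Dinv\<close>
  is used for it.\<close>

definition nonloc :: "'k::field_char_0 \<Rightarrow> 'k \<Rightarrow> nat \<Rightarrow> 'k dpoly" where
  "nonloc \<alpha> \<beta> i = Dinv (qv * c_seq \<alpha> \<beta> i - rv * b_seq \<alpha> \<beta> i)"

lemma cb_0: "c_seq \<alpha> \<beta> 0 = 0" "b_seq \<alpha> \<beta> 0 = 0"
  by (simp_all add: c_seq_def b_seq_def)

lemma cb_1: "c_seq \<alpha> \<beta> (Suc 0) = rv" "b_seq \<alpha> \<beta> (Suc 0) = qv"
  by (simp_all add: c_seq_def b_seq_def)

lemma nonloc_0: "nonloc \<alpha> \<beta> 0 = 0"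
  by (simp add: nonloc_def cb_0)

lemma nonloc_1: "nonloc \<alpha> \<beta> (Suc 0) = 0"
  by (simp add: nonloc_def cb_1 mult.commute)

lemma a_seq_0: "a_seq \<alpha> \<beta> 0 = 1"
  by (simp add: a_seq_def)

text \<open>Fails at i = 0, where the right side is 0 but a_0 = 1.\<close>

lemma a_seq_nonloc:
  "i > 0 \<Longrightarrow> a_seq \<alpha> \<beta> i = Const \<alpha> * nonloc \<alpha> \<beta> i + Const \<beta> * nonloc \<alpha> \<beta> (Suc i)"
  by (simp add: a_seq_def nonloc_def)

lemma op_apply_mat22:
  "op_apply (mat22 A B C E) w $ 1 = A (w $ 1) + B (w $ 2)"
  "op_apply (mat22 A B C E) w $ 2 = C (w $ 1) + E (w $ 2)"
  by (simp_all add: op_apply_def mat22_def sum_2)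

text \<open>Adding the two entries of a row of \<Psi> merges their nonlocal terms by linearity of
  \<open>Dinv\<close>; the common factor of r and q that appears is a_i.\<close>

lemma cb_Suc_Suc:
  fixes \<alpha> \<beta> :: "'k::field_char_0"
  assumes "i > 0"
  shows "c_seq \<alpha> \<beta> (Suc i) = - Const (1/2) * D (c_seq \<alpha> \<beta> i) + rv * a_seq \<alpha> \<beta> i"
    and "b_seq \<alpha> \<beta> (Suc i) = Const (1/2) * D (b_seq \<alpha> \<beta> i) + qv * a_seq \<alpha> \<beta> i"
proof -
  define c b f h where "c = c_seq \<alpha> \<beta> i" "b = b_seq \<alpha> \<beta> i" "f = nonloc \<alpha> \<beta> i"
    and "h = (Const (1/2) :: 'k dpoly)"
  note defs = this
  \<comment> \<open>The value that f_(i+1) will turn out to have.\<close>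
  define g where "g = - h * Dinv (qv * D c + rv * D b)"
  obtain k where i: "i = Suc k" using assms gr0_conv_Suc by blast
  have f: "Dinv (qv * c) - Dinv (rv * b) = f"
    by (simp add: defs nonloc_def Dinv_diff)
  have g: "h * (Dinv (qv * D c) + Dinv (rv * D b)) = - g"
    by (simp add: g_def Dinv_add)
  have c': "c_seq \<alpha> \<beta> (Suc i) = - h * D c + Const \<alpha> * rv * (Dinv (qv * c) - Dinv (rv * b))
      - Const \<beta> * rv * (h * (Dinv (qv * D c) + Dinv (rv * D b)))"
    unfolding defs
    by (simp add: i c_seq_def b_seq_def Psi_op_def op_apply_mat22 Const_divide_2[of \<beta>] algebra_simps)
  have b': "b_seq \<alpha> \<beta> (Suc i) = h * D b + Const \<alpha> * qv * (Dinv (qv * c) - Dinv (rv * b))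
      - Const \<beta> * qv * (h * (Dinv (qv * D c) + Dinv (rv * D b)))"
    unfolding defs
    by (simp add: i c_seq_def b_seq_def Psi_op_def op_apply_mat22 Const_divide_2[of \<beta>] algebra_simps)
  have c'': "c_seq \<alpha> \<beta> (Suc i) = - h * D c + rv * (Const \<alpha> * f + Const \<beta> * g)"
    unfolding c' f g by (simp add: algebra_simps)
  have b'': "b_seq \<alpha> \<beta> (Suc i) = h * D b + qv * (Const \<alpha> * f + Const \<beta> * g)"
    unfolding b' f g by (simp add: algebra_simps)
  \<comment> \<open>The common factor cancels in q c - r b, leaving only the derivative terms;
    applying \<open>Dinv\<close> identifies f_(i+1) with \<open>g\<close>.\<close>
  have "qv * c_seq \<alpha> \<beta> (Suc i) - rv * b_seq \<alpha> \<beta> (Suc i) = Const (- (1/2)) * (qv * D c + rv * D b)"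
    unfolding c'' b'' Const_uminus h_def by (simp add: algebra_simps)
  then have "nonloc \<alpha> \<beta> (Suc i) = g"
    unfolding nonloc_def by (simp add: Dinv_scale Dinv_uminus g_def h_def Const_uminus)
  then have "a_seq \<alpha> \<beta> i = Const \<alpha> * f + Const \<beta> * g"
    using assms by (simp add: a_seq_nonloc defs)
  with c'' b'' show "c_seq \<alpha> \<beta> (Suc i) = - Const (1/2) * D (c_seq \<alpha> \<beta> i) + rv * a_seq \<alpha> \<beta> i"
    "b_seq \<alpha> \<beta> (Suc i) = Const (1/2) * D (b_seq \<alpha> \<beta> i) + qv * a_seq \<alpha> \<beta> i"
    by (simp_all add: defs)
qed

text \<open>The recursion extends to i = 0 because a_0 = 1 produces c_1 = r and b_1 = q. The factor
  1/2 is cleared for ring arithmetic.\<close>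

lemma cb_Suc:
  fixes \<alpha> \<beta> :: "'k::field_char_0"
  shows "2 * c_seq \<alpha> \<beta> (Suc i) = - D (c_seq \<alpha> \<beta> i) + 2 * rv * a_seq \<alpha> \<beta> i"
    and "2 * b_seq \<alpha> \<beta> (Suc i) = D (b_seq \<alpha> \<beta> i) + 2 * qv * a_seq \<alpha> \<beta> i"
proof -
  show "2 * c_seq \<alpha> \<beta> (Suc i) = - D (c_seq \<alpha> \<beta> i) + 2 * rv * a_seq \<alpha> \<beta> i"
    by (cases "i = 0")
      (simp_all add: cb_0 cb_1 a_seq_0 cb_Suc_Suc distrib_left right_diff_distrib half_double mult.assoc)
  show "2 * b_seq \<alpha> \<beta> (Suc i) = D (b_seq \<alpha> \<beta> i) + 2 * qv * a_seq \<alpha> \<beta> i"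
    by (cases "i = 0")
      (simp_all add: cb_0 cb_1 a_seq_0 cb_Suc_Suc distrib_left half_double mult.assoc)
qed

subsection \<open>Locality\<close>

text \<open>Coefficientwise, so \<open>fps_X\<close>, which stands for 1/\<lambda>, counts as a
  constant.\<close>

definition fps_D :: "'k::comm_ring_1 dpoly fps \<Rightarrow> 'k dpoly fps" where
  "fps_D F = Abs_fps (\<lambda>n. D (fps_nth F n))"

lemma fps_D_nth [simp]: "fps_nth (fps_D F) n = D (fps_nth F n)"
  by (simp add: fps_D_def)

lemma fps_D_add: "fps_D (F + G) = fps_D F + fps_D G"
  by (rule fps_ext) (simp add: D_add)

lemma fps_D_mult: "fps_D (F * G) = fps_D F * G + F * fps_D G"
  by (rule fps_ext) (simp add: fps_mult_nth D_sum D_mult sum.distrib)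

lemma fps_D_X [simp]: "fps_D fps_X = 0"
  by (rule fps_ext) (simp add: fps_X_def)

lemma fps_D_const: "fps_D (fps_const c) = fps_const (D c)"
  by (rule fps_ext) simp

lemma D_nonloc:
  fixes \<alpha> \<beta> :: "'k::field_char_0"
  shows "D (nonloc \<alpha> \<beta> i) = qv * c_seq \<alpha> \<beta> i - rv * b_seq \<alpha> \<beta> i"
proof (cases i)
  case 0
  then show ?thesis by (simp add: nonloc_0 cb_0)
next
  case (Suc n)
  define \<kappa> :: "'k dpoly fps" where "\<kappa> = fps_const (Const \<alpha>) * fps_X + fps_const (Const \<beta>)"
  \<comment> \<open>\<open>P\<close>, \<open>B\<close> and \<open>C\<close> start at index 1, but
    \<open>A\<close> at index 0.\<close>
  define P where "P = Abs_fps (\<lambda>n. nonloc \<alpha> \<beta> (Suc n))"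
  define B where "B = Abs_fps (\<lambda>n. b_seq \<alpha> \<beta> (Suc n))"
  define C where "C = Abs_fps (\<lambda>n. c_seq \<alpha> \<beta> (Suc n))"
  define G where "G = fps_const qv * C - fps_const rv * B"
  define Q where "Q = \<kappa> * P * P + fps_X * B * C"
  define A where "A = Abs_fps (a_seq \<alpha> \<beta>)"
  \<comment> \<open>Coefficient n of \<kappa>P is \<alpha> f_n + \<beta> f_(n+1) = a_n for n > 0. At
    n = 0 it is \<beta> f_1 = 0, hence the - 1.\<close>
  have A: "\<kappa> * P = A - 1"
  proof (rule fps_ext)
    fix n
    show "fps_nth (\<kappa> * P) n = fps_nth (A - 1) n"
      by (cases n)
        (simp_all add: A_def \<kappa>_def P_def distrib_right mult.assoc a_seq_0 a_seq_nonloc nonloc_1)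
  qed
  \<comment> \<open>The factor \<open>fps_X\<close> undoes the index shift of \<open>B\<close>;
    coefficient 0 fits because b_0 = 0.\<close>
  have B: "2 * B = fps_X * fps_D B + 2 * fps_const qv * A"
  proof (rule fps_ext)
    fix n
    show "fps_nth (2 * B) n = fps_nth (fps_X * fps_D B + 2 * fps_const qv * A) n"
      using cb_Suc(2)[of \<alpha> \<beta> n]
      by (cases n) (simp_all add: fps_numeral_fps_const mult.assoc A_def B_def cb_0)
  qed
  have C: "2 * C = 2 * fps_const rv * A - fps_X * fps_D C"
  proof (rule fps_ext)
    fix n
    show "fps_nth (2 * C) n = fps_nth (2 * fps_const rv * A - fps_X * fps_D C) n"
      using cb_Suc(1)[of \<alpha> \<beta> n]
      by (cases n) (simp_all add: fps_numeral_fps_const mult.assoc A_def C_def cb_0)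
  qed
  have "fps_D Q = 2 * \<kappa> * P * fps_D P + (fps_X * fps_D B) * C + B * (fps_X * fps_D C)"
    by (simp add: Q_def \<kappa>_def fps_D_add fps_D_mult fps_D_const algebra_simps)
  also have "fps_X * fps_D B = 2 * B - 2 * fps_const qv * A"
    unfolding B by simp
  also have "fps_X * fps_D C = 2 * fps_const rv * A - 2 * C"
    unfolding C by simp
  also have "2 * \<kappa> * P * fps_D P = 2 * (A - 1) * fps_D P"
    unfolding mult.assoc[of 2] A ..
  \<comment> \<open>The BC terms cancel and the others leave -2AG, split by A = (A - 1) + 1.\<close>
  finally have DQ: "fps_D Q = 2 * (A - 1) * (fps_D P - G) - 2 * G"
    unfolding G_def by (simp add: algebra_simps)
  have "fps_nth (fps_D P) n = fps_nth G n" for n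
  proof (induction n rule: less_induct)
    case (less n)
    \<comment> \<open>For j = 0 the first factor vanishes since a_0 = 1; for j > 0 the second does
      by induction.\<close>
    have "fps_nth (A - 1) j * fps_nth (fps_D P - G) (n - j) = 0" if "j \<le> n" for j
      using less[of "n - j"] that by (cases "j = 0") (auto simp: A_def a_seq_0)
    then have "fps_nth ((A - 1) * (fps_D P - G)) n = 0"
      by (subst fps_mult_nth) (auto intro: sum.neutral)
    then have "D (fps_nth Q n) = - 2 * fps_nth G n"
      using arg_cong[OF DQ, of "\<lambda>F. fps_nth F n"]
      by (simp add: fps_numeral_fps_const mult.assoc)
    then have "Const (1/2) * D (fps_nth Q n) = - (Const (1/2) + Const (1/2)) * fps_nth G n"
      by (simp add: algebra_simps)
    then have "fps_nth G n = D (- (Const (1/2) * fps_nth Q n))"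
      by (simp add: D_uminus D_scale Const_half)
    \<comment> \<open>Coefficient n of \<open>P\<close> is \<open>Dinv\<close> of that of
      \<open>G\<close>, so it suffices that the latter is a total derivative.\<close>
    then have "D (Dinv (fps_nth G n)) = fps_nth G n"
      by (metis D_Dinv_D)
    then show ?case by (simp add: P_def nonloc_def G_def B_def C_def)
  qed
  then show ?thesis by (simp add: Suc P_def G_def B_def C_def)
qed


subsection \<open>The hierarchy\<close>

lemma K_vec_nonloc:
  fixes \<alpha> \<beta> :: "'k::field_char_0"
  shows "K_vec \<alpha> \<beta> n $ 1 = 2 * b_seq \<alpha> \<beta> (Suc n) - 2 * Const \<beta> * qv * nonloc \<alpha> \<beta> (Suc n)"
    and "K_vec \<alpha> \<beta> n $ 2 = - 2 * c_seq \<alpha> \<beta> (Suc n) + 2 * Const \<beta> * rv * nonloc \<alpha> \<beta> (Suc n)"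
  unfolding K_vec_def J_op_def op_apply_mat22 nonloc_def Const_mult Const_2 Dinv_diff
  by (simp_all add: c_seq_def b_seq_def algebra_simps)

lemma M_op_cb_nonloc:
  fixes \<alpha> \<beta> :: "'k::field_char_0"
  shows "op_apply (M_op \<alpha>) (cb_seq \<alpha> \<beta> n) $ 1
    = D (b_seq \<alpha> \<beta> n) + 2 * Const \<alpha> * qv * nonloc \<alpha> \<beta> n"
    and "op_apply (M_op \<alpha>) (cb_seq \<alpha> \<beta> n) $ 2
    = D (c_seq \<alpha> \<beta> n) - 2 * Const \<alpha> * rv * nonloc \<alpha> \<beta> n"
  unfolding M_op_def op_apply_mat22 nonloc_def Const_mult Const_2 Dinv_diff
  by (simp_all add: c_seq_def b_seq_def algebra_simps)

text \<open>The \<beta> terms of J cancel the part \<beta> f_(n+1) of a_n, leaving \<alpha> f_n. At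
  n = 0 the extra a_0 = 1 would break this: M gives 0, but K_0 = (2q, -2r).\<close>

lemma K_vec_eq_M_op:
  fixes \<alpha> \<beta> :: "'k::field_char_0"
  assumes "n > 0"
  shows "K_vec \<alpha> \<beta> n = op_apply (M_op \<alpha>) (cb_seq \<alpha> \<beta> n)"
proof -
  have "K_vec \<alpha> \<beta> n $ i = op_apply (M_op \<alpha>) (cb_seq \<alpha> \<beta> n) $ i" for i
    using exhaust_2[of i] assms cb_Suc[of \<alpha> \<beta> n]
    by (auto simp: K_vec_nonloc M_op_cb_nonloc a_seq_nonloc algebra_simps)
  then show ?thesis by (simp add: vec_eq_iff)
qed

lemma K_vec_0:
  fixes \<alpha> \<beta> :: "'k::field_char_0"
  shows "K_vec \<alpha> \<beta> 0 = vector [2 * qv, - 2 * rv]"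
  by (simp add: vec_eq_iff forall_2 K_vec_nonloc nonloc_1 cb_1)

text \<open>This is \<Phi> J = M evaluated on (c_(n+1), b_(n+1)), followed by
  \<open>K_vec_eq_M_op\<close>; linearity of \<open>Dinv\<close> suffices.\<close>

lemma K_vec_Suc:
  fixes \<alpha> \<beta> :: "'k::field_char_0"
  shows "K_vec \<alpha> \<beta> (Suc n) = op_apply (Phi_op \<alpha> \<beta>) (K_vec \<alpha> \<beta> n)"
proof -
  define c b f where "c = c_seq \<alpha> \<beta> (Suc n)" "b = b_seq \<alpha> \<beta> (Suc n)" "f = nonloc \<alpha> \<beta> (Suc n)"
  note defs = this
  define h where "h = Const (1/2 :: 'k)"
  have h: "2 * (h * p) = p" for p
    unfolding h_def by (rule half_double)
  define X Y where "X = K_vec \<alpha> \<beta> n $ 1" "Y = K_vec \<alpha> \<beta> n $ 2"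
  have X: "X = 2 * (b - Const \<beta> * qv * f)" and Y: "Y = - (2 * (c - Const \<beta> * rv * f))"
    by (simp_all add: X_Y_def K_vec_nonloc defs algebra_simps)
  \<comment> \<open>The \<beta> terms cancel, so the nonlocal part of \<Phi> K_n is a multiple of
    f_(n+1) alone.\<close>
  have "rv * X + qv * Y = Const (- 2) * (qv * c - rv * b)"
    by (simp add: X Y Const_uminus Const_2 algebra_simps)
  then have "Dinv (rv * X) + Dinv (qv * Y) = Const (- 2) * f"
    by (simp only: Dinv_add[symmetric] Dinv_scale nonloc_def defs)
  then have Dinv_XY: "Dinv (rv * X) + Dinv (qv * Y) = - (2 * f)"
    by (simp add: Const_uminus Const_2)
  have "op_apply (Phi_op \<alpha> \<beta>) (K_vec \<alpha> \<beta> n) $ 1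
      = h * D X - Const \<alpha> * qv * (Dinv (rv * X) + Dinv (qv * Y))
        - h * Const \<beta> * D (qv * (Dinv (rv * X) + Dinv (qv * Y)))"
    unfolding Phi_op_def op_apply_mat22 Const_divide_2[of \<beta>] X_Y_def h_def
    by (simp add: D_add algebra_simps)
  \<comment> \<open>The derivative of \<beta> q f inside X cancels against the last term.\<close>
  also have "\<dots> = D b + 2 * Const \<alpha> * qv * f"
    unfolding Dinv_XY unfolding X
        by (simp add: D_mult_2 D_uminus D_diff D_scale h mult.assoc mult.left_commute[of _ 2]
          right_diff_distrib)
  finally have "op_apply (Phi_op \<alpha> \<beta>) (K_vec \<alpha> \<beta> n) $ 1 = D b + 2 * Const \<alpha> * qv * f" .
  moreover have "op_apply (Phi_op \<alpha> \<beta>) (K_vec \<alpha> \<beta> n) $ 2 = D c - 2 * Const \<alpha> * rv * f"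
  proof -
    have "op_apply (Phi_op \<alpha> \<beta>) (K_vec \<alpha> \<beta> n) $ 2
      = - h * D Y + Const \<alpha> * rv * (Dinv (rv * X) + Dinv (qv * Y))
        - h * Const \<beta> * D (rv * (Dinv (rv * X) + Dinv (qv * Y)))"
      unfolding Phi_op_def op_apply_mat22 Const_divide_2[of \<beta>] X_Y_def h_def
      by (simp add: D_add algebra_simps)
    also have "\<dots> = D c - 2 * Const \<alpha> * rv * f"
      unfolding Dinv_XY unfolding Y
        by (simp add: D_mult_2 D_uminus D_diff D_scale h mult.assoc mult.left_commute[of _ 2]
          right_diff_distrib)
    finally show ?thesis .
  qed
  ultimately show ?thesis
    by (simp add: vec_eq_iff forall_2 K_vec_eq_M_op M_op_cb_nonloc defs)
qed

lemma K_vec_eq_Phi_op_power: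
  fixes \<alpha> \<beta> :: "'k::field_char_0"
  shows "K_vec \<alpha> \<beta> n = (op_apply (Phi_op \<alpha> \<beta>) ^^ n) (vector [2 * qv, - 2 * rv])"
  by (induction n) (simp_all add: K_vec_0 K_vec_Suc)

subsection \<open>The zero curvature identity\<close>

lemma mat22_nth:
  "mat22 a b c d $ 1 $ 1 = a" "mat22 a b c d $ 1 $ 2 = b"
  "mat22 a b c d $ 2 $ 1 = c" "mat22 a b c d $ 2 $ 2 = d"
  by (simp_all add: mat22_def)

lemma mat22_eq_iff:
  "A = B \<longleftrightarrow> A $ 1 $ 1 = B $ 1 $ 1 \<and> A $ 1 $ 2 = B $ 1 $ 2 \<and> A $ 2 $ 1 = B $ 2 $ 1 \<and> A $ 2 $ 2 = B $ 2 $ 2"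
  for A B :: "'a^2^2"
  by (simp add: vec_eq_iff forall_2 conj_assoc)

text \<open>The polynomial part in \<lambda> of \<lambda>^n times the series of s_j \<lambda>^(-j);
  \<open>Vsum_Suc\<close> is its Horner step and drives the inductions on n.\<close>

definition Vsum :: "(nat \<Rightarrow> 'k::comm_ring_1 dpoly) \<Rightarrow> 'k \<Rightarrow> nat \<Rightarrow> 'k dpoly" where
  "Vsum s l n = (\<Sum>j=0..n. s j * Const (l ^ (n - j)))"

lemma Vsum_0: "Vsum s l 0 = s 0"
  by (simp add: Vsum_def)

lemma Vsum_Suc: "Vsum s l (Suc n) = Const l * Vsum s l n + s (Suc n)"
  by (simp add: Vsum_def sum_distrib_left Suc_diff_le Const_mult ac_simps)

lemma V_mat_nth:
  "V_mat \<alpha> \<beta> n l $ 1 $ 1 = Vsum (a_seq \<alpha> \<beta>) l n + delta1 \<alpha> \<beta> n"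
  "V_mat \<alpha> \<beta> n l $ 1 $ 2 = Vsum (b_seq \<alpha> \<beta>) l n"
  "V_mat \<alpha> \<beta> n l $ 2 $ 1 = Const (\<alpha> + \<beta> * l) * Vsum (c_seq \<alpha> \<beta>) l n"
  "V_mat \<alpha> \<beta> n l $ 2 $ 2 = - (Vsum (a_seq \<alpha> \<beta>) l n + delta1 \<alpha> \<beta> n)"
  by (simp_all add: V_mat_def mat22_nth Vsum_def delta2_def sum_distrib_left sum_negf mult.assoc)

text \<open>For n > 0 the \<alpha> terms cancel; for n = 0 both sides vanish because f_1 =
  0.\<close>

lemma delta1_nonloc:
  fixes \<alpha> \<beta> :: "'k::field_char_0"
  shows "delta1 \<alpha> \<beta> n = - (Const \<beta> * nonloc \<alpha> \<beta> (Suc n))"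
  by (cases "n = 0") (simp_all add: delta1_def nonloc_1 a_seq_nonloc, simp add: nonloc_def)

text \<open>The stationary equation b_x = 2\<lambda>b - 2qa, with 2 b_(n+1) as the remainder of
  truncation. The recursion makes the intermediate terms telescope.\<close>

lemma D_Vsum_b:
  fixes \<alpha> \<beta> :: "'k::field_char_0"
  shows "D (Vsum (b_seq \<alpha> \<beta>) l n)
    = 2 * Const l * Vsum (b_seq \<alpha> \<beta>) l n - 2 * qv * Vsum (a_seq \<alpha> \<beta>) l n + 2 * b_seq \<alpha> \<beta> (Suc n)"
proof (induction n)
  case 0
  show ?case by (simp add: Vsum_0 cb_0 cb_1 a_seq_0)
next
  case (Suc n)
  show ?case
    unfolding Vsum_Suc D_add D_scale Suc cb_Suc(2)[of \<alpha> \<beta> "Suc n"] by (simp add: algebra_simps)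
qed

lemma D_Vsum_c:
  fixes \<alpha> \<beta> :: "'k::field_char_0"
  shows "D (Vsum (c_seq \<alpha> \<beta>) l n)
    = 2 * rv * Vsum (a_seq \<alpha> \<beta>) l n - 2 * Const l * Vsum (c_seq \<alpha> \<beta>) l n - 2 * c_seq \<alpha> \<beta> (Suc n)"
proof (induction n)
  case 0
  show ?case by (simp add: Vsum_0 cb_0 cb_1 a_seq_0)
next
  case (Suc n)
  show ?case
    unfolding Vsum_Suc D_add D_scale Suc cb_Suc(1)[of \<alpha> \<beta> "Suc n"] by (simp add: algebra_simps)
qed

text \<open>The only place where locality enters: each step turns the old remainder, times
  \<lambda>, into \<beta>\<lambda>(q c - r b) at the new index.\<close>

lemma D_Vsum_a:
  fixes \<alpha> \<beta> :: "'k::field_char_0"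
  shows "D (Vsum (a_seq \<alpha> \<beta>) l n)
    = Const (\<alpha> + \<beta> * l) * (qv * Vsum (c_seq \<alpha> \<beta>) l n - rv * Vsum (b_seq \<alpha> \<beta>) l n)
      + Const \<beta> * D (nonloc \<alpha> \<beta> (Suc n))"
proof (induction n)
  case 0
  show ?case by (simp add: Vsum_0 cb_0 nonloc_1 a_seq_0)
next
  case (Suc n)
  show ?case
    unfolding Vsum_Suc D_add D_scale Suc
    by (simp add: a_seq_nonloc D_add D_scale D_nonloc[of \<alpha> \<beta> "Suc n"] Const_add Const_mult algebra_simps)
qed

lemma commutator_22:
  fixes A B :: "'k::comm_ring_1^2^2"
  shows "commutator A B $ 1 $ 1 = A$1$2 * B$2$1 - A$2$1 * B$1$2"
    and "commutator A B $ 1 $ 2 = A$1$2 * (B$2$2 - B$1$1) + B$1$2 * (A$1$1 - A$2$2)"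
    and "commutator A B $ 2 $ 1 = A$2$1 * (B$1$1 - B$2$2) + B$2$1 * (A$2$2 - A$1$1)"
    and "commutator A B $ 2 $ 2 = A$2$1 * B$1$2 - A$1$2 * B$2$1"
  by (simp_all add: commutator_def matrix_matrix_mult_def sum_2 algebra_simps)

text \<open>The correction -\<beta> f_(n+1) acts twice: its derivative cancels the diagonal
  remainder, and its product with the off-diagonal entries of U turns the remainders 2b and -2c at n
  + 1 into K_n.\<close>

lemma zero_curvature_identity:
  fixes \<alpha> \<beta> :: "'k::field_char_0"
  shows "(\<chi> i j. D (V_mat \<alpha> \<beta> n l $ i $ j))
    = mat22 0 (K_vec \<alpha> \<beta> n $ 1) (Const (\<alpha> + \<beta> * l) * K_vec \<alpha> \<beta> n $ 2) 0
      + commutator (U_mat \<alpha> \<beta> l) (V_mat \<alpha> \<beta> n l)"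
  unfolding mat22_eq_iff
  by (simp add: mat22_nth U_mat_def commutator_22 V_mat_nth K_vec_nonloc D_diff D_uminus D_scale
      delta1_nonloc D_Vsum_a D_Vsum_b D_Vsum_c, simp add: algebra_simps)

subsection \<open>Evaluation\<close>

definition jet_at :: "(real \<Rightarrow> real \<Rightarrow> 'k::real_normed_field^2) \<Rightarrow> real \<Rightarrow> real \<Rightarrow> jetvar \<Rightarrow> 'k" where
  "jet_at u x t v = (dx ^^ snd v) u x t $ fst v"

definition monom_at :: "(jetvar \<Rightarrow> 'k::comm_monoid_mult) \<Rightarrow> (jetvar \<Rightarrow>\<^sub>0 nat) \<Rightarrow> 'k" where
  "monom_at X m = (\<Prod>v\<in>Poly_Mapping.keys m. X v ^ Poly_Mapping.lookup m v)"

lemma monom_at_superset: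
  assumes "finite A" "Poly_Mapping.keys m \<subseteq> A"
  shows "monom_at X m = (\<Prod>v\<in>A. X v ^ Poly_Mapping.lookup m v)"
  unfolding monom_at_def using assms by (intro prod.mono_neutral_left) (auto simp: in_keys_iff)

lemma monom_at_add: "monom_at X (m + m') = monom_at X m * monom_at X m'"
proof -
  define A where "A = Poly_Mapping.keys m \<union> Poly_Mapping.keys m'"
  have "finite A" "Poly_Mapping.keys m \<subseteq> A" "Poly_Mapping.keys m' \<subseteq> A"
    "Poly_Mapping.keys (m + m') \<subseteq> A"
    unfolding A_def using keys_add[of m m'] by auto
  then show ?thesis
    by (simp add: monom_at_superset[of A] lookup_add power_add prod.distrib)
qed

lemma eval_at_monom_at:
  "eval_at p u x t = (\<Sum>m\<in>Poly_Mapping.keys p. Poly_Mapping.lookup p m * monom_at (jet_at u x t) m)"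
  by (simp add: eval_at_def monom_at_def jet_at_def)

lemma eval_at_single: "eval_at (Poly_Mapping.single m c) u x t = c * monom_at (jet_at u x t) m"
  by (simp add: eval_at_monom_at)

lemma eval_at_add: "eval_at (p + q) u x t = eval_at p u x t + eval_at q u x t"
  unfolding eval_at_monom_at by (rule setsum_keys_plus_distrib) (simp_all add: distrib_right)

text \<open>Both sides are additive in each factor, so single terms suffice.\<close>

lemma eval_at_mult: "eval_at (p * q) u x t = eval_at p u x t * eval_at q u x t"
proof (induction p rule: poly_mapping_additive_induct)
  case (single m c)
  show ?case
    by (induction q rule: poly_mapping_additive_induct)
      (simp_all add: mult_single eval_at_single monom_at_add eval_at_add algebra_simps)
qed (simp add: eval_at_add algebra_simps)

lemma eval_at_Const [simp]: "eval_at (Const c) u x t = c"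
  by (simp add: Const_def eval_at_single monom_at_def)

lemma eval_at_jet_var: "eval_at (jet_var v) u x t = (dx ^^ snd v) u x t $ fst v"
  by (simp add: jet_var_def eval_at_single monom_at_def jet_at_def)

lemma eval_at_qv: "eval_at qv u x t = u x t $ 1" and eval_at_rv: "eval_at rv u x t = u x t $ 2"
  by (simp_all add: qv_def rv_def eval_at_jet_var)

lemma eval_at_0 [simp]: "eval_at 0 u x t = 0"
  by (simp add: eval_at_def)

lemma eval_at_uminus: "eval_at (- p) u x t = - eval_at p u x t"
  using eval_at_add[of p "- p" u x t] by (simp add: eq_neg_iff_add_eq_0 add.commute)

lemma eval_at_diff: "eval_at (p - q) u x t = eval_at p u x t - eval_at q u x t"
  using eval_at_add[of p "- q" u x t] by (simp add: eval_at_uminus)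

lemma eval_mat_add: "eval_mat (A + B) u x t = eval_mat A u x t + eval_mat B u x t"
  by (simp add: eval_mat_def vec_eq_iff eval_at_add)

lemma eval_mat_commutator:
  "eval_mat (commutator A B) u x t = commutator (eval_mat A u x t) (eval_mat B u x t)"
  unfolding mat22_eq_iff commutator_22
  by (simp add: eval_mat_def commutator_22 eval_at_add eval_at_diff eval_at_mult)

subsection \<open>Differentiation of evaluated differential polynomials\<close>

text \<open>Difference quotients converge componentwise. For matrices this is applied to rows, then
  to entries.\<close>

lemma has_vector_derivative_vec:
  fixes f :: "real \<Rightarrow> 'v::real_normed_vector^'n"
  assumes "\<And>i. ((\<lambda>y. f y $ i) has_vector_derivative f' $ i) (at x)"
  shows "(f has_vector_derivative f') (at x)"
proof -
  have "((\<lambda>y. ((f y - f x) - (y - x) *\<^sub>R f') /\<^sub>R norm (y - x)) \<longlongrightarrow> 0) (at x)"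
    using assms
    by (intro vec_tendstoI) (simp add: has_vector_derivative_def has_derivative_at_within)
  then show ?thesis
    by (simp add: has_vector_derivative_def has_derivative_at_within bounded_linear_scaleR_left)
qed

lemma has_vector_derivative_vec_nth:
  "(f has_vector_derivative f') F \<Longrightarrow> ((\<lambda>y. f y $ i) has_vector_derivative f' $ i) F"
  by (rule bounded_linear.has_vector_derivative[OF bounded_linear_vec_nth])

text \<open>On a jet variable this is the existence of all x-derivatives; the product rule does the
  rest.\<close>

lemma eval_at_has_vector_derivative_dx:
  assumes "admissible_on S u" "(x, t) \<in> S"
  shows "((\<lambda>y. eval_at p u y t) has_vector_derivative eval_at (D p) u x t) (at x)"
proof (induction p rule: dpoly_induct)
  case (Const c)
  show ?case by simp
next
  case (jet_var v)
  have "(\<lambda>y. (dx ^^ snd v) u y t) differentiable (at x)"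
    using assms by (auto simp: admissible_on_def)
  then have "((\<lambda>y. (dx ^^ snd v) u y t) has_vector_derivative (dx ^^ Suc (snd v)) u x t) (at x)"
    by (simp add: dx_def vector_derivative_works)
  then show ?case
    by (cases v) (simp add: D_jet_var eval_at_jet_var has_vector_derivative_vec_nth)
next
  case (add p q)
  then show ?case by (simp add: eval_at_add D_add has_vector_derivative_add)
next
  case (mult p q)
  then show ?case
    using has_vector_derivative_mult[OF mult] by (simp add: eval_at_mult eval_at_add D_mult add.commute)
qed

lemma dx_eval_mat:
  assumes "admissible_on S u" "(x, t) \<in> S"
  shows "dx (eval_mat A u) x t = eval_mat (\<chi> i j. D (A $ i $ j)) u x t"
  unfolding dx_def
  by (intro vector_derivative_at has_vector_derivative_vec)
    (simp add: eval_mat_def eval_at_has_vector_derivative_dx[OF assms])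

text \<open>The entries of U are affine in u and free of x-derivatives, so no mixed derivatives
  arise.\<close>

lemma dt_eval_U_mat:
  assumes "admissible_on S u" "(x, t) \<in> S"
  shows "dt (eval_mat (U_mat \<alpha> \<beta> l) u) x t
    = mat22 0 (dt u x t $ 1) ((\<alpha> + \<beta> * l) * dt u x t $ 2) 0"
proof -
  have "(\<lambda>s. u x s) differentiable (at t)"
    using assms by (auto simp: admissible_on_def)
  then have u: "((\<lambda>s. u x s) has_vector_derivative dt u x t) (at t)"
    by (simp add: dt_def vector_derivative_works)
  have "((\<lambda>s. eval_mat (U_mat \<alpha> \<beta> l) u x s $ i $ j) has_vector_derivative
      mat22 0 (dt u x t $ 1) ((\<alpha> + \<beta> * l) * dt u x t $ 2) 0 $ i $ j) (at t)" for i j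
    using exhaust_2[of i] exhaust_2[of j] has_vector_derivative_vec_nth[OF u]
      has_vector_derivative_mult_right[OF has_vector_derivative_vec_nth[OF u]]
    by (auto simp: eval_mat_def U_mat_def mat22_nth eval_at_mult eval_at_uminus eval_at_qv eval_at_rv)
  then show ?thesis
    unfolding dt_def by (intro vector_derivative_at has_vector_derivative_vec)
qed

section \<open>Equivalence of zero curvature and evolution\<close>

lemma zero_curvature_defect:
  assumes "admissible_on S u" "(x, t) \<in> S"
  shows "dt (eval_mat (U_mat \<alpha> \<beta> l) u) x t - dx (eval_mat (V_mat \<alpha> \<beta> n l) u) x t
      + commutator (eval_mat (U_mat \<alpha> \<beta> l) u x t) (eval_mat (V_mat \<alpha> \<beta> n l) u x t)
    = mat22 0 ((dt u x t - eval_vec (K_vec \<alpha> \<beta> n) u x t) $ 1)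
        ((\<alpha> + \<beta> * l) * (dt u x t - eval_vec (K_vec \<alpha> \<beta> n) u x t) $ 2) 0"
  unfolding dt_eval_U_mat[OF assms] dx_eval_mat[OF assms] zero_curvature_identity eval_mat_add
    eval_mat_commutator
  by (simp add: mat22_eq_iff mat22_nth eval_mat_def eval_vec_def eval_at_mult right_diff_distrib)

lemma zero_curvature_on_iff_evolution_on:
  assumes "\<alpha>\<^sup>2 + \<beta>\<^sup>2 \<noteq> 0" "admissible_on S u"
  shows "zero_curvature_on S u (U_mat \<alpha> \<beta>) (V_mat \<alpha> \<beta> n) \<longleftrightarrow> evolution_on S u (K_vec \<alpha> \<beta> n)"
proof -
  \<comment> \<open>The hypothesis excludes \<alpha> = \<beta> = 0, so \<alpha> + \<beta>\<lambda>
    is nonzero at 0 or at 1.\<close>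
  obtain l0 where l0: "\<alpha> + \<beta> * l0 \<noteq> 0"
  proof (cases "\<alpha> = 0")
    case True
    then show ?thesis using assms(1) that[of 1] by simp
  next
    case False
    then show ?thesis using that[of 0] by simp
  qed
  \<comment> \<open>The upper entry gives the first component; the lower entry at \<open>l0\<close>
    gives the second.\<close>
  have "(\<forall>l. mat22 0 (w $ 1) ((\<alpha> + \<beta> * l) * w $ 2) 0 = 0) \<longleftrightarrow> w = 0" for w :: "'a^2"
    using l0 by (auto simp: mat22_eq_iff mat22_nth vec_eq_iff forall_2)
  then have "(\<forall>l. dt (eval_mat (U_mat \<alpha> \<beta> l) u) x t - dx (eval_mat (V_mat \<alpha> \<beta> n l) u) x t
      + commutator (eval_mat (U_mat \<alpha> \<beta> l) u x t) (eval_mat (V_mat \<alpha> \<beta> n l) u x t) = 0)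
    \<longleftrightarrow> dt u x t = eval_vec (K_vec \<alpha> \<beta> n) u x t" if "(x, t) \<in> S" for x t
    unfolding zero_curvature_defect[OF assms(2) that] by (simp only: right_minus_eq)
  then show ?thesis
    unfolding zero_curvature_on_def evolution_on_def by blast
qed

theorem mainTheorem4:
  fixes \<alpha> \<beta> :: "'k::real_normed_field"
    and n :: nat
  assumes "\<alpha>\<^sup>2 + \<beta>\<^sup>2 \<noteq> 0"
  shows
    "K_vec \<alpha> \<beta> n = (op_apply (Phi_op \<alpha> \<beta>) ^^ n) (vector [2 * qv, - 2 * rv]) \<and>
     (n \<ge> 1 \<longrightarrow> K_vec \<alpha> \<beta> n = op_apply (M_op \<alpha>) (cb_seq \<alpha> \<beta> n)) \<and>
     (n = 0 \<longrightarrow> K_vec \<alpha> \<beta> n = vector [2 * qv, - 2 * rv]) \<and>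
     (\<forall>S (u :: real \<Rightarrow> real \<Rightarrow> 'k^2). open S \<longrightarrow> admissible_on S u \<longrightarrow>
        (zero_curvature_on S u (U_mat \<alpha> \<beta>) (V_mat \<alpha> \<beta> n) \<longleftrightarrow>
         evolution_on S u (K_vec \<alpha> \<beta> n)))"
  using K_vec_eq_Phi_op_power[of \<alpha> \<beta> n] K_vec_eq_M_op[of n \<alpha> \<beta>] K_vec_0[of \<alpha> \<beta>]
    zero_curvature_on_iff_evolution_on[OF assms]
  by (intro conjI allI impI) auto

end
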